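(* Let $d_1,d_2>0$ be integers and let $p_0,p_1,p_2\in R$ be bihomogeneous polynomials of degree $(d_1,d_2)$ with no common zeros on $\mathbb{P}^1\times\mathbb{P}^1$. Then the Koszul complex $$0\to R(-3d_1,-3d_2)\xrightarrow{\ \varphi_0\ }R(-2d_1,-2d_2)^3\xrightarrow{\ \varphi_1\ }R(-d_1,-d_2)^3\xrightarrow{\ \varphi_2\ }R$$ with $$\varphi_0=\begin{bmatrix}p_2\\ -p_1\\ p_0\end{bmatrix},\qquad \varphi_1=\begin{bmatrix}p_1&p_2&0\\ -p_0&0&p_2\\ 0&-p_0&-p_1\end{bmatrix},\qquad \varphi_2=\begin{bmatrix}p_0&p_1&p_2\end{bmatrix}$$ is not exact (that is, it is not exact at all of the three modules $R(-3d_1,-3d_2)$, $R(-2d_1,-2d_2)^3$, $R(-d_1,-d_2)^3$).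
   Context: $k$ is an algebraically closed field and $R=k[x,y,z,w]$ is bigraded with $x,y$ of degree $(1,0)$ and $z,w$ of degree $(0,1)$; $R_{m,n}$ is the graded piece of degree $(m,n)$ and $R(-a,-b)$ is the shifted free module with $R(-a,-b)_{m,n}=R_{m-a,n-b}$. The variables $x,y$ are homogeneous coordinates on the first factor of $\mathbb{P}^1\times\mathbb{P}^1$ and $z,w$ on the second. *)

theory Defs
  imports
    "HOL-Analysis.Cartesian_Space"
    "HOL-Library.Poly_Mapping"
    "HOL-Library.Numeral_Type"
    "HOL-Computational_Algebra.Polynomial"
begin

datatype indet = Ix | Iy | Iz | Iw

text \<open>
  The ring \<open>R = k[x,y,z,w]\<close>: finitely supported functions from exponent vectors to
  coefficients, with the convolution product of \<open>Poly_Mapping\<close>.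
\<close>

type_synonym 'k bipoly = "(indet \<Rightarrow>\<^sub>0 nat) \<Rightarrow>\<^sub>0 'k"

definition eval_bipoly :: "'k::comm_ring_1 bipoly \<Rightarrow> 'k \<times> 'k \<Rightarrow> 'k \<times> 'k \<Rightarrow> 'k" where
  "eval_bipoly f u v =
    (\<Sum>t\<in>Poly_Mapping.keys f. Poly_Mapping.lookup f t
        * fst u ^ Poly_Mapping.lookup t Ix * snd u ^ Poly_Mapping.lookup t Iy
        * fst v ^ Poly_Mapping.lookup t Iz * snd v ^ Poly_Mapping.lookup t Iw)"

text \<open>
  Degrees are integers so that shifted degrees may be negative; the pieces are then zero.
  Every piece contains the zero polynomial.
\<close>

definition R_piece :: "int \<Rightarrow> int \<Rightarrow> 'k::comm_ring_1 bipoly set" where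
  "R_piece m n = {f. \<forall>t\<in>Poly_Mapping.keys f.
      int (Poly_Mapping.lookup t Ix + Poly_Mapping.lookup t Iy) = m \<and>
      int (Poly_Mapping.lookup t Iz + Poly_Mapping.lookup t Iw) = n}"

text \<open>
  \<open>free_piece a b m n\<close> is the piece of bidegree \<open>(m,n)\<close> of the free module \<open>R(-a,-b)\<^sup>r\<close>, where
  \<open>r = CARD('r)\<close>. The underlying module, for every shift, is the whole type of column vectors.
\<close>

definition free_piece :: "int \<Rightarrow> int \<Rightarrow> int \<Rightarrow> int \<Rightarrow> ('k::comm_ring_1 bipoly ^ 'r) set" where
  "free_piece a b m n = {v. \<forall>i. v $ i \<in> R_piece (m - a) (n - b)}"

definition degree_preserving ::
    "('u \<Rightarrow> 'v) \<Rightarrow> (int \<Rightarrow> int \<Rightarrow> 'u set) \<Rightarrow> (int \<Rightarrow> int \<Rightarrow> 'v set) \<Rightarrow> bool" where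
  "degree_preserving f M N \<longleftrightarrow> (\<forall>m n. f ` M m n \<subseteq> N m n)"

definition exact_at :: "('u \<Rightarrow> 'v) \<Rightarrow> ('v \<Rightarrow> 'w::zero) \<Rightarrow> bool" where
  "exact_at f g \<longleftrightarrow> range f = {v. g v = 0}"

definition koszul0 :: "'k::comm_ring_1 bipoly \<Rightarrow> 'k bipoly \<Rightarrow> 'k bipoly \<Rightarrow> 'k bipoly ^ 1 ^ 3" where
  "koszul0 p0 p1 p2 = vector [vector [p2],
                              vector [- p1],
                              vector [p0]]"

definition koszul1 :: "'k::comm_ring_1 bipoly \<Rightarrow> 'k bipoly \<Rightarrow> 'k bipoly \<Rightarrow> 'k bipoly ^ 3 ^ 3" where
  "koszul1 p0 p1 p2 = vector [vector [p1,    p2,    0],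
                              vector [- p0,  0,     p2],
                              vector [0,     - p0,  - p1]]"

definition koszul2 :: "'k::comm_ring_1 bipoly \<Rightarrow> 'k bipoly \<Rightarrow> 'k bipoly \<Rightarrow> 'k bipoly ^ 3 ^ 1" where
  "koszul2 p0 p1 p2 = vector [vector [p0, p1, p2]]"

definition proportional :: "(('k::field \<times> 'k) \<times> ('k \<times> 'k)) set" where
  "proportional = {((a, b), (a', b')). (a, b) \<noteq> (0, 0) \<and> (a', b') \<noteq> (0, 0) \<and>
      (\<exists>c. c \<noteq> 0 \<and> a' = c * a \<and> b' = c * b)}"

text \<open>A point of \<open>P\<^sup>1\<close> is the set of all its pairs of homogeneous coordinates.\<close>

definition P1 :: "('k::field \<times> 'k) set set" where
  "P1 = (UNIV - {(0, 0)}) // proportional"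

definition vanishes_at :: "'k::field bipoly \<Rightarrow> ('k \<times> 'k) set \<times> ('k \<times> 'k) set \<Rightarrow> bool" where
  "vanishes_at f P \<longleftrightarrow> (\<forall>u\<in>fst P. \<forall>v\<in>snd P. eval_bipoly f u v = 0)"

end

theory Submission
  imports Defs
begin

text \<open>
  In bidegree \<open>(3d\<^sub>1, 2d\<^sub>2 - 1)\<close> the source of \<open>\<phi>\<^sub>2\<close> has dimension \<open>3(2d\<^sub>1 + 1)d\<^sub>2\<close>, which exceeds
  the dimension \<open>(3d\<^sub>1 + 1)2d\<^sub>2\<close> of its target, whereas the source of \<open>\<phi>\<^sub>1\<close> vanishes there because
  its degree in \<open>z,w\<close> would be \<open>-1\<close>. Hence \<open>\<phi>\<^sub>2\<close> has a nonzero syzygy in this bidegree that does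
  not come from \<open>\<phi>\<^sub>1\<close>.
\<close>

text \<open>Gaussian elimination, by induction on the set of equations: an equation with all
  coefficients zero is dropped, any other one is used to eliminate one unknown, which keeps fewer
  equations than unknowns.\<close>

lemma underdetermined_homogeneous_system:
  fixes a :: "'i \<Rightarrow> 'j \<Rightarrow> 'k::field"
  assumes "finite I" "finite J" "card I < card J"
  shows "\<exists>c. (\<exists>j\<in>J. c j \<noteq> 0) \<and> (\<forall>i\<in>I. (\<Sum>j\<in>J. a i j * c j) = 0)"
  using assms
proof (induction I arbitrary: J a rule: finite_induct)
  case empty
  then obtain j where "j \<in> J" by fastforce
  then show ?case by (intro exI[of _ "\<lambda>_. 1"]) auto
next
  case (insert i0 I)
  show ?case
  proof (cases "\<forall>j\<in>J. a i0 j = 0")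
    case True
    have "card I < card J" using insert by simp
    from insert.IH[OF insert.prems(1) this, of a] True show ?thesis
      by auto
  next
    case False
    then obtain j0 where j0: "j0 \<in> J" "a i0 j0 \<noteq> 0" by auto
    have "card I < card (J - {j0})" using insert j0 by simp
    \<comment> \<open>The new coefficients result from subtracting \<open>a i j0 / a i0 j0\<close>
      times equation \<open>i0\<close> from equation \<open>i\<close>, which removes the unknown
      \<open>j0\<close>.\<close>
    then obtain c where c: "\<exists>j\<in>J - {j0}. c j \<noteq> 0"
      and eq: "\<And>i. i \<in> I \<Longrightarrow> (\<Sum>j\<in>J - {j0}. (a i j - a i j0 * a i0 j / a i0 j0) * c j) = 0"
      using insert.IH[of "J - {j0}" "\<lambda>i j. a i j - a i j0 * a i0 j / a i0 j0"] insert.prems(1)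
      by auto
    define s where "s = (\<Sum>j\<in>J - {j0}. a i0 j * c j)"
    \<comment> \<open>Back substitution: the value at \<open>j0\<close> is the one that makes
      equation \<open>i0\<close> hold.\<close>
    define c' where "c' = c(j0 := - s / a i0 j0)"
    have sum_c': "(\<Sum>j\<in>J. a i j * c' j) =
        - a i j0 * s / a i0 j0 + (\<Sum>j\<in>J - {j0}. a i j * c j)" for i
    proof -
      have "(\<Sum>j\<in>J. a i j * c' j) = a i j0 * c' j0 + (\<Sum>j\<in>J - {j0}. a i j * c' j)"
        using insert.prems(1) j0(1) by (rule sum.remove)
      also have "(\<Sum>j\<in>J - {j0}. a i j * c' j) = (\<Sum>j\<in>J - {j0}. a i j * c j)"
        by (rule sum.cong) (auto simp: c'_def)
      finally show ?thesis by (simp add: c'_def)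
    qed
    have "(\<Sum>j\<in>J. a i j * c' j) = 0" if "i \<in> I" for i
    proof -
      have "(\<Sum>j\<in>J - {j0}. a i j * c j) - a i j0 / a i0 j0 * s
          = (\<Sum>j\<in>J - {j0}. (a i j - a i j0 * a i0 j / a i0 j0) * c j)"
        unfolding s_def sum_distrib_left sum_subtractf[symmetric]
        by (rule sum.cong) (auto simp: algebra_simps)
      then show ?thesis using eq[OF that] by (simp add: sum_c')
    qed
    moreover have "(\<Sum>j\<in>J. a i0 j * c' j) = 0"
      using j0 by (simp add: sum_c' flip: s_def)
    moreover have "\<exists>j\<in>J. c' j \<noteq> 0" using c by (auto simp: c'_def)
    ultimately show ?thesis by blast
  qed
qed

lemma R_piece_0 [simp]: "0 \<in> R_piece m n"
  by (simp add: R_piece_def)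

lemma R_piece_add: "f \<in> R_piece m n \<Longrightarrow> g \<in> R_piece m n \<Longrightarrow> f + g \<in> R_piece m n"
  using Poly_Mapping.keys_add[of f g] unfolding R_piece_def by fastforce

lemma R_piece_sum: "(\<And>i. i \<in> A \<Longrightarrow> f i \<in> R_piece m n) \<Longrightarrow> sum f A \<in> R_piece m n"
  by (induction A rule: infinite_finite_induct) (auto intro: R_piece_add)

lemma R_piece_uminus [simp]: "- f \<in> R_piece m n \<longleftrightarrow> f \<in> R_piece m n"
  by (simp add: R_piece_def)

lemma R_piece_mult:
  assumes "f \<in> R_piece m n" "g \<in> R_piece m' n'"
  shows "f * g \<in> R_piece (m + m') (n + n')"
  using assms keys_mult[of f g] unfolding R_piece_def by (fastforce simp: lookup_add)

text \<open>The degree of the entries makes up for the difference of the shifts: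
  \<open>(a - a') + (m - a) = m - a'\<close>, and likewise for \<open>b\<close>.\<close>

lemma matrix_mult_R_piece:
  fixes A :: "'k::comm_ring_1 bipoly ^ 'c ^ 'r"
  assumes "\<And>i j. A $ i $ j \<in> R_piece (a - a') (b - b')"
  shows "degree_preserving ((*v) A) (free_piece a b) (free_piece a' b')"
proof -
  have "(\<Sum>j\<in>UNIV. A $ i $ j * v $ j) \<in> R_piece (m - a') (n - b')"
    if "\<forall>j. v $ j \<in> R_piece (m - a) (n - b)" for v i m n
  proof (rule R_piece_sum)
    fix j
    show "A $ i $ j * v $ j \<in> R_piece (m - a') (n - b')"
      using R_piece_mult[OF assms, of "v $ j" "m - a" "n - b" i j] that by simp
  qed
  then show ?thesis
    by (auto simp: degree_preserving_def free_piece_def matrix_vector_mult_def)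
qed

definition monomials :: "nat \<Rightarrow> nat \<Rightarrow> (indet \<Rightarrow>\<^sub>0 nat) set" where
  "monomials a b = {t. Poly_Mapping.lookup t Ix + Poly_Mapping.lookup t Iy = a \<and>
    Poly_Mapping.lookup t Iz + Poly_Mapping.lookup t Iw = b}"

text \<open>Once the bidegree is fixed, the exponents of \<open>x\<close> and \<open>z\<close>
  determine those of \<open>y\<close> and \<open>w\<close>. This yields the dimension of a graded
  piece.\<close>

lemma bij_betw_monomials:
  "bij_betw (\<lambda>t. (Poly_Mapping.lookup t Ix, Poly_Mapping.lookup t Iz))
    (monomials a b) ({..a} \<times> {..b})"
proof (rule bij_betwI)
  let ?g = "\<lambda>(i, j). Poly_Mapping.single Ix i + Poly_Mapping.single Iy (a - i)
    + Poly_Mapping.single Iz j + Poly_Mapping.single Iw (b - j)"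
  show "?g \<in> {..a} \<times> {..b} \<rightarrow> monomials a b"
    by (auto simp: monomials_def lookup_add lookup_single when_def)
  show "?g (Poly_Mapping.lookup t Ix, Poly_Mapping.lookup t Iz) = t" if "t \<in> monomials a b" for t
  proof (rule poly_mapping_eqI)
    fix v
    show "Poly_Mapping.lookup (?g (Poly_Mapping.lookup t Ix, Poly_Mapping.lookup t Iz)) v
      = Poly_Mapping.lookup t v"
      using that by (cases v) (auto simp: monomials_def lookup_add lookup_single when_def)
  qed
qed (auto simp: monomials_def lookup_add lookup_single when_def)

lemma finite_monomials [simp]: "finite (monomials a b)"
  using bij_betw_finite[OF bij_betw_monomials[of a b]] by simp

lemma card_monomials: "card (monomials a b) = (a + 1) * (b + 1)"
  using bij_betw_same_card[OF bij_betw_monomials[of a b]] by simp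

lemma R_piece_iff_monomials:
  "f \<in> R_piece (int a) (int b) \<longleftrightarrow> Poly_Mapping.keys f \<subseteq> monomials a b"
  unfolding R_piece_def monomials_def of_nat_eq_iff by blast

text \<open>Pulls an unknown coefficient \<open>x\<close> out of a product, so that the coefficients
  of \<open>p * q\<close> become linear forms in the coefficients of \<open>q\<close>.\<close>

lemma lookup_mult_single:
  fixes f :: "'a::comm_monoid_add \<Rightarrow>\<^sub>0 'b::comm_semiring_1"
  shows "Poly_Mapping.lookup (f * Poly_Mapping.single t x) s
    = Poly_Mapping.lookup (f * Poly_Mapping.single t 1) s * x"
proof -
  \<comment> \<open>The scalar \<open>x\<close> is split off as a constant polynomial, and
    multiplication by a constant acts coefficientwise.\<close>
  have "f * Poly_Mapping.single t x = Poly_Mapping.single 0 x * (f * Poly_Mapping.single t 1)"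
    by (simp add: mult.left_commute mult_single)
  also have "\<dots> = Poly_Mapping.map ((*) x) (f * Poly_Mapping.single t 1)"
    by (rule mult_map_scale_conv_mult[symmetric])
  finally show ?thesis
    by (simp only: map.rep_eq) (simp add: when_def mult.commute)
qed

text \<open>The unknowns are the coefficients of all \<open>q i\<close>, the equations say that each
  coefficient of the sum in bidegree \<open>(a + a', b + b')\<close> is zero. The hypothesis
  \<open>card\<close> says that there are more unknowns than equations.\<close>

lemma exists_syzygy:
  fixes p :: "'r::finite \<Rightarrow> 'k::field bipoly"
  assumes p: "\<And>i. p i \<in> R_piece (int a) (int b)"
    and card: "(a + a' + 1) * (b + b' + 1) < CARD('r) * ((a' + 1) * (b' + 1))"
  shows "\<exists>q. (\<forall>i. q i \<in> R_piece (int a') (int b')) \<and> (\<exists>i. q i \<noteq> 0) \<and>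
    (\<Sum>i\<in>UNIV. p i * q i) = 0"
proof -
  let ?J = "(UNIV :: 'r set) \<times> monomials a' b'" and ?I = "monomials (a + a') (b + b')"
  have "card ?I < card ?J"
    using card by (simp add: card_monomials card_cartesian_product)
  from underdetermined_homogeneous_system[OF _ _ this,
      of "\<lambda>s (i, t). Poly_Mapping.lookup (p i * Poly_Mapping.single t 1) s"]
  obtain c where c: "\<exists>j\<in>?J. c j \<noteq> 0"
    and eq: "\<And>s. s \<in> ?I \<Longrightarrow>
      (\<Sum>(i, t)\<in>?J. Poly_Mapping.lookup (p i * Poly_Mapping.single t 1) s * c (i, t)) = 0"
    by (auto simp: case_prod_unfold)
  define q where "q i = (\<Sum>t\<in>monomials a' b'. Poly_Mapping.single t (c (i, t)))" for i
  have lookup_q: "Poly_Mapping.lookup (q i) t = c (i, t)" if "t \<in> monomials a' b'" for i t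
    using that by (simp add: q_def lookup_sum lookup_single when_def)
  have q: "q i \<in> R_piece (int a') (int b')" for i
    unfolding q_def by (intro R_piece_sum) (auto simp: R_piece_iff_monomials)
  have "(\<Sum>i\<in>UNIV. p i * q i) = 0"
  proof (rule poly_mapping_eqI)
    fix s
    show "Poly_Mapping.lookup (\<Sum>i\<in>UNIV. p i * q i) s = Poly_Mapping.lookup 0 s"
    proof (cases "s \<in> ?I")
      case True
      have "Poly_Mapping.lookup (\<Sum>i\<in>UNIV. p i * q i) s
          = (\<Sum>i\<in>UNIV. \<Sum>t\<in>monomials a' b'.
            Poly_Mapping.lookup (p i * Poly_Mapping.single t (c (i, t))) s)"
        by (simp add: q_def lookup_sum sum_distrib_left)
      also have "\<dots> = (\<Sum>(i, t)\<in>?J. Poly_Mapping.lookup (p i * Poly_Mapping.single t 1) s * c (i, t))"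
        unfolding sum.cartesian_product by (intro sum.cong refl) (clarify, rule lookup_mult_single)
      finally show ?thesis using eq[OF True] by simp
    next
      \<comment> \<open>Monomials outside \<open>?I\<close> give no equation; their coefficients
        vanish because the sum is bihomogeneous.\<close>
      case False
      have "(\<Sum>i\<in>UNIV. p i * q i) \<in> R_piece (int (a + a')) (int (b + b'))"
        using R_piece_mult[OF p q] by (intro R_piece_sum) simp
      then show ?thesis
        using False unfolding R_piece_iff_monomials by (auto simp: in_keys_iff)
    qed
  qed
  moreover have "\<exists>i. q i \<noteq> 0"
  proof -
    from c obtain i t where "t \<in> monomials a' b'" "c (i, t) \<noteq> 0" by auto
    then have "Poly_Mapping.lookup (q i) t \<noteq> 0" by (simp add: lookup_q)
    then show ?thesis by (metis lookup_zero)
  qed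
  ultimately show ?thesis using q by blast
qed

text \<open>Exactness concerns the whole modules, so a preimage \<open>w\<close> may be
  inhomogeneous. Still, each monomial of the product is a multiple of a monomial of some entry of
  \<open>A\<close>, which bounds its degree in \<open>z,w\<close> from below.\<close>

lemma keys_matrix_vector_mult_zw_degree:
  fixes A :: "'k::comm_ring_1 bipoly ^ 'c ^ 'r"
  assumes A: "\<And>i j. A $ i $ j \<in> R_piece a b"
    and t: "t \<in> Poly_Mapping.keys ((A *v w) $ i)"
  shows "b \<le> int (Poly_Mapping.lookup t Iz + Poly_Mapping.lookup t Iw)"
proof -
  have "t \<in> (\<Union>j. Poly_Mapping.keys (A $ i $ j * w $ j))"
    using t keys_sum[of "\<lambda>j. A $ i $ j * w $ j" UNIV]
    by (auto simp: matrix_vector_mult_def)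
  then obtain j u v where "u \<in> Poly_Mapping.keys (A $ i $ j)" "t = u + v"
    using keys_mult by fastforce
  then show ?thesis using A[of i j] by (auto simp: R_piece_def lookup_add)
qed

theorem mainTheorem1:
  fixes d1 d2 :: int
    and p0 p1 p2 :: "'k::alg_closed_field bipoly"
  assumes "d1 > 0" and "d2 > 0"
    and "p0 \<in> R_piece d1 d2" and "p1 \<in> R_piece d1 d2" and "p2 \<in> R_piece d1 d2"
    and "\<not> (\<exists>P \<in> P1 \<times> P1. vanishes_at p0 P \<and> vanishes_at p1 P \<and> vanishes_at p2 P)"
  shows
    "degree_preserving ((*v) (koszul0 p0 p1 p2))
        (free_piece (3 * d1) (3 * d2)) (free_piece (2 * d1) (2 * d2)) \<and>
     degree_preserving ((*v) (koszul1 p0 p1 p2))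
        (free_piece (2 * d1) (2 * d2)) (free_piece d1 d2) \<and>
     degree_preserving ((*v) (koszul2 p0 p1 p2))
        (free_piece d1 d2) (free_piece 0 0) \<and>
     koszul1 p0 p1 p2 ** koszul0 p0 p1 p2 = 0 \<and>
     koszul2 p0 p1 p2 ** koszul1 p0 p1 p2 = 0 \<and>
     \<not> (exact_at (\<lambda>_::unit. 0) ((*v) (koszul0 p0 p1 p2)) \<and>
        exact_at ((*v) (koszul0 p0 p1 p2)) ((*v) (koszul1 p0 p1 p2)) \<and>
        exact_at ((*v) (koszul1 p0 p1 p2)) ((*v) (koszul2 p0 p1 p2)))"
proof (intro conjI)
  \<comment> \<open>The column index has a one-element type; quantifying over it lets simplification
    reduce it to its only value.\<close>
  have "\<forall>j. koszul0 p0 p1 p2 $ i $ j \<in> R_piece d1 d2" for i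
    using assms(3-5) exhaust_3[of i] by (auto simp: koszul0_def)
  then have k0: "koszul0 p0 p1 p2 $ i $ j \<in> R_piece d1 d2" for i j
    by blast
  have k1: "koszul1 p0 p1 p2 $ i $ j \<in> R_piece d1 d2" for i j
    using assms(3-5) exhaust_3[of i] exhaust_3[of j] by (auto simp: koszul1_def)
  have "\<forall>i. koszul2 p0 p1 p2 $ i $ j \<in> R_piece d1 d2" for j
    using assms(3-5) exhaust_3[of j] by (auto simp: koszul2_def)
  then have k2: "koszul2 p0 p1 p2 $ i $ j \<in> R_piece d1 d2" for i j
    by blast
  show "degree_preserving ((*v) (koszul0 p0 p1 p2))
        (free_piece (3 * d1) (3 * d2)) (free_piece (2 * d1) (2 * d2))"
    by (rule matrix_mult_R_piece) (simp add: k0)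
  show "degree_preserving ((*v) (koszul1 p0 p1 p2))
        (free_piece (2 * d1) (2 * d2)) (free_piece d1 d2)"
    by (rule matrix_mult_R_piece) (simp add: k1)
  show "degree_preserving ((*v) (koszul2 p0 p1 p2)) (free_piece d1 d2) (free_piece 0 0)"
    by (rule matrix_mult_R_piece) (simp add: k2)
  show "koszul1 p0 p1 p2 ** koszul0 p0 p1 p2 = 0"
    by (simp add: vec_eq_iff forall_3 matrix_matrix_mult_def sum_3 koszul0_def koszul1_def)
  show "koszul2 p0 p1 p2 ** koszul1 p0 p1 p2 = 0"
    by (simp add: vec_eq_iff forall_3 matrix_matrix_mult_def sum_3 koszul1_def koszul2_def)
  show "\<not> (exact_at (\<lambda>_::unit. 0) ((*v) (koszul0 p0 p1 p2)) \<and>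
        exact_at ((*v) (koszul0 p0 p1 p2)) ((*v) (koszul1 p0 p1 p2)) \<and>
        exact_at ((*v) (koszul1 p0 p1 p2)) ((*v) (koszul2 p0 p1 p2)))"
  proof
    assume "exact_at (\<lambda>_::unit. 0) ((*v) (koszul0 p0 p1 p2)) \<and>
        exact_at ((*v) (koszul0 p0 p1 p2)) ((*v) (koszul1 p0 p1 p2)) \<and>
        exact_at ((*v) (koszul1 p0 p1 p2)) ((*v) (koszul2 p0 p1 p2))"
    \<comment> \<open>Exactness is refuted at \<open>R(-d1,-d2)^3\<close>.\<close>
    then have exact: "range ((*v) (koszul1 p0 p1 p2)) = {v. koszul2 p0 p1 p2 *v v = 0}"
      by (simp add: exact_at_def)
    obtain a where a: "d1 = int a" using assms(1) nonneg_int_cases[of d1] by auto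
    \<comment> \<open>The syzygy will have entries of bidegree \<open>(2 * d1, d2 - 1)\<close>.
      Positivity of \<open>d2\<close> makes \<open>b' = d2 - 1\<close> a natural number.\<close>
    obtain b' where b': "d2 = int (b' + 1)"
      using assms(2) zero_less_imp_eq_int[of d2] by (metis Suc_eq_plus1 Suc_pred)
    have p: "koszul2 p0 p1 p2 $ 1 $ i \<in> R_piece (int a) (int (b' + 1))" for i
      using k2 unfolding a b' .
    \<comment> \<open>The right side exceeds the left by exactly \<open>b' + 1\<close>, that is, by
      \<open>d2\<close>.\<close>
    have "(a + 2 * a + 1) * ((b' + 1) + b' + 1) < CARD(3) * ((2 * a + 1) * (b' + 1))"
      by (simp add: algebra_simps)
    from exists_syzygy[of "\<lambda>i. koszul2 p0 p1 p2 $ 1 $ i", OF p this] obtain q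
      where q: "\<And>i. q i \<in> R_piece (int (2 * a)) (int b')" "\<exists>i. q i \<noteq> 0"
        and syz: "(\<Sum>i\<in>UNIV. koszul2 p0 p1 p2 $ 1 $ i * q i) = 0"
      by blast
    have "koszul2 p0 p1 p2 *v (\<chi> i. q i) = 0"
      using syz by (simp add: vec_eq_iff matrix_vector_mult_def)
    then obtain w where w: "(\<chi> i. q i) = koszul1 p0 p1 p2 *v w"
      using exact by blast
    from q(2) obtain i t where t: "t \<in> Poly_Mapping.keys (q i)" by (metis keys_eq_empty ex_in_conv)
    then have "t \<in> Poly_Mapping.keys ((koszul1 p0 p1 p2 *v w) $ i)" by (simp flip: w)
    \<comment> \<open>The two degrees in \<open>z,w\<close> clash by one: an element of the image of
      \<open>koszul1\<close> has only monomials of degree at least \<open>d2\<close>, whereas those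
      of \<open>q i\<close> have degree \<open>d2 - 1\<close>.\<close>
    from keys_matrix_vector_mult_zw_degree[OF k1 this]
    have "b' + 1 \<le> Poly_Mapping.lookup t Iz + Poly_Mapping.lookup t Iw"
      by (simp add: b')
    moreover have "Poly_Mapping.lookup t Iz + Poly_Mapping.lookup t Iw = b'"
      using q(1)[of i] t unfolding R_piece_iff_monomials by (auto simp: monomials_def)
    ultimately show False by simp
  qed
qed

end
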